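(* Let $\mathcal{R}$ be a unital ring with involution, let $m\in\mathcal{R}$ be invertible with $m^*=m$, and let $a,b,ab\in\mathcal{R}^{\mathrm{core},m}$. Then $(ab)^{\mathrm{core},m}=b^{\mathrm{core},m}a^{\mathrm{core},m}$ if and only if $$b(ab)^{\mathrm{core},m}=b\,b^{\mathrm{core},m}a^{\mathrm{core},m}\quad\text{and}\quad ab\,b^{\mathrm{core},m}=b^{\mathrm{core},m}bab\,b^{\mathrm{core},m}.$$
   Context: $\mathcal{R}$ is a (not necessarily commutative) unital ring with an involution $x\mapsto x^*$ satisfying $(xy)^*=y^*x^*$, $(x+y)^*=x^*+y^*$, $(x^* )^*=x$. For an invertible $m\in\mathcal{R}$ with $m^*=m$, an element $z\in\mathcal{R}$ is the $m$-weighted core inverse of $a\in\mathcal{R}$ if $aza=a$, $z\mathcal{R}=a\mathcal{R}$ and $\mathcal{R}z=\mathcal{R}a^*m$. It is unique if it exists and is denoted $a^{\mathrm{core},m}$; $\mathcal{R}^{\mathrm{core},m}$ is the set of elements that have an $m$-weighted core inverse. *)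

theory Defs
  imports Main
begin

text \<open>Unital rings with involution. The class is built on \<open>monoid_mult\<close> rather than on
  \<open>ring_1\<close> because \<open>ring_1\<close> imposes \<open>0 \<noteq> 1\<close>, which would exclude the zero ring.\<close>

class involutive_ring = ring + monoid_mult +
  fixes star :: "'a \<Rightarrow> 'a"
  assumes star_mult: "star (x * y) = star y * star x"
    and star_add: "star (x + y) = star x + star y"
    and star_star: "star (star x) = x"

definition two_sided_invertible :: "'a::monoid_mult \<Rightarrow> bool" where
  "two_sided_invertible m \<longleftrightarrow> (\<exists>n. m * n = 1 \<and> n * m = 1)"

definition right_principal :: "'a::times \<Rightarrow> 'a set" where
  "right_principal x = {x * r | r. True}"

definition left_principal :: "'a::times \<Rightarrow> 'a set" where
  "left_principal x = {r * x | r. True}"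

definition is_core_inverse :: "'a::involutive_ring \<Rightarrow> 'a \<Rightarrow> 'a \<Rightarrow> bool" where
  "is_core_inverse m a z \<longleftrightarrow>
     a * z * a = a \<and>
     right_principal z = right_principal a \<and>
     left_principal z = left_principal (star a * m)"

definition core_invertibles :: "'a::involutive_ring \<Rightarrow> 'a set" where
  "core_invertibles m = {a. \<exists>z. is_core_inverse m a z}"

text \<open>Meaningful only for invertible self-adjoint \<open>m\<close> and \<open>a \<in> core_invertibles m\<close>; see
  \<open>is_core_inverse_unique\<close> and \<open>core_inverse_eqI\<close> below.\<close>

definition core_inverse :: "'a::involutive_ring \<Rightarrow> 'a \<Rightarrow> 'a" where
  "core_inverse m a = (THE z. is_core_inverse m a z)"

lemma self_in_principal:
  fixes x :: "'a::involutive_ring"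
  shows "x \<in> right_principal x" and "x \<in> left_principal x"
  unfolding right_principal_def left_principal_def
  by (simp_all, metis mult_1_right, metis mult_1_left)

lemma is_core_inverse_outer:
  fixes m a w :: "'a::involutive_ring"
  assumes m: "two_sided_invertible m" "star m = m" and w: "is_core_inverse m a w"
  shows "w * a * w = w"
proof -
  obtain n where n: "m * n = 1" "n * m = 1"
    using m(1) by (auto simp: two_sided_invertible_def)
  have "star n = star n * (m * n)" using n by simp
  also have "\<dots> = star (m * n) * n" by (simp add: star_mult m(2) mult.assoc)
  also have "\<dots> = star 1 * n" using n by simp
  also have "star (1::'a) = 1" by (metis star_mult star_star mult_1_left mult_1_right)
  finally have n_star: "star n = n" by simp
  have "w \<in> left_principal (star a * m)"
    using w self_in_principal(2)[of w] by (simp add: is_core_inverse_def)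
  then obtain s where s: "w = s * (star a * m)"
    by (auto simp: left_principal_def)
  have "star a = star (a * w * a)" using w by (simp add: is_core_inverse_def)
  then have a_star: "star a = star a * star w * star a" by (simp add: star_mult mult.assoc)
  define P where "P = m * a * w"
  have P_star: "star P = star w * star a * m"
    by (simp add: P_def star_mult m(2) mult.assoc)
  have "w * n * star P = s * star a * (m * n) * star w * star a * m"
    by (simp add: s P_star mult.assoc)
  also have "\<dots> = s * (star a * star w * star a) * m"
    using n by (simp add: mult.assoc)
  also have "\<dots> = w" using a_star s by (simp add: mult.assoc)
  finally have w_eq: "w * n * star P = w" .
  have P_eq: "P * n * star P = P"
    unfolding P_def using w_eq[unfolded P_def] by (metis mult.assoc)
  have "star P = star (P * n * star P)" by (simp add: P_eq)
  also have "\<dots> = P * n * star P" by (simp add: star_mult star_star n_star mult.assoc)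
  finally have "star P = P" by (simp add: P_eq)
  then have "w = w * n * (m * a * w)" using w_eq by (simp add: P_def)
  also have "\<dots> = w * (n * m) * a * w" by (simp add: mult.assoc)
  finally show ?thesis using n by simp
qed

lemma is_core_inverse_unique:
  fixes m a z w :: "'a::involutive_ring"
  assumes m: "two_sided_invertible m" "star m = m"
    and z: "is_core_inverse m a z" and w: "is_core_inverse m a w"
  shows "z = w"
proof -
  have "z \<in> left_principal w"
    using z w self_in_principal(2)[of z] by (simp add: is_core_inverse_def)
  then obtain u where u: "z = u * w"
    by (auto simp: left_principal_def)
  have "w \<in> right_principal z"
    using z w self_in_principal(1)[of w] by (simp add: is_core_inverse_def)
  then obtain v where v: "w = z * v"
    by (auto simp: right_principal_def)
  have "z * a * w = z"
    using is_core_inverse_outer[OF m w] u by (metis mult.assoc)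
  moreover have "z * a * w = w"
    using is_core_inverse_outer[OF m z] v by (metis mult.assoc)
  ultimately show ?thesis by simp
qed

lemma core_inverse_eqI:
  fixes m a z :: "'a::involutive_ring"
  assumes "two_sided_invertible m" "star m = m" "is_core_inverse m a z"
  shows "core_inverse m a = z"
  unfolding core_inverse_def
  using assms is_core_inverse_unique by (intro the_equality) blast+

end

theory Submission imports Defs begin

text \<open>Write \<open>x\<close>, \<open>y\<close>, \<open>z\<close> for the \<open>m\<close>-weighted core inverses of \<open>ab\<close>, \<open>b\<close>, \<open>a\<close>. The
  element \<open>yb\<close> is an idempotent that generates the right ideal \<open>y\<R>\<close>, so left
  multiplication by \<open>yb\<close> fixes exactly the elements of \<open>y\<R>\<close>. Cancelling the right factor
  \<open>y\<close> by means of \<open>byb = b\<close>, the second condition \<open>aby = (yb)aby\<close> becomes \<open>ab = (yb)ab\<close>,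
  that is, \<open>ab \<in> y\<R>\<close>. Since \<open>x\<close> and \<open>ab\<close> generate the same right ideal, this says that
  \<open>x \<in> y\<R>\<close>, equivalently \<open>x = ybx\<close>. If \<open>x = yz\<close>, this membership is clear, and the first
  condition \<open>bx = byz\<close> is immediate. Conversely, if \<open>x = ybx\<close>, multiplying the first
  condition on the left by \<open>y\<close> gives \<open>x = y(bx) = (yby)z = yz\<close>.\<close>

lemma is_core_inverse_core_inverse:
  fixes m a :: "'a::involutive_ring"
  assumes "two_sided_invertible m" "star m = m" "a \<in> core_invertibles m"
  shows "is_core_inverse m a (core_inverse m a)"
  using assms core_inverse_eqI by (auto simp: core_invertibles_def)

lemma right_principal_subset_iff:
  fixes x y :: "'a::involutive_ring"
  shows "right_principal x \<subseteq> right_principal y \<longleftrightarrow> x \<in> right_principal y"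
  using self_in_principal(1)[of x] by (auto simp: right_principal_def mult.assoc)

text \<open>The identity \<open>y b y = y\<close> makes \<open>y b\<close> an idempotent with the same right ideal as \<open>y\<close>, so
  membership in that ideal amounts to being fixed by left multiplication by \<open>y b\<close>.\<close>

lemma in_right_principal_outer_inverse_iff:
  fixes b y c :: "'a::involutive_ring"
  assumes "y * b * y = y"
  shows "c \<in> right_principal y \<longleftrightarrow> y * b * c = c"
proof
  assume "c \<in> right_principal y"
  then obtain r where "c = y * r" by (auto simp: right_principal_def)
  then show "y * b * c = c" using assms by (metis mult.assoc)
next
  assume "y * b * c = c"
  then have "c = y * (b * c)" by (simp add: mult.assoc)
  then show "c \<in> right_principal y" by (auto simp: right_principal_def)
qed

text \<open>The condition on \<open>a b y\<close> is a disguised statement about right ideals: \<open>y\<close> can be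
  cancelled on the right because \<open>b y b = b\<close>.\<close>

lemma in_right_principal_iff_absorbs:
  fixes a b y :: "'a::involutive_ring"
  assumes inner: "b * y * b = b" and outer: "y * b * y = y"
  shows "a * b \<in> right_principal y \<longleftrightarrow> a * b * y = y * b * a * b * y"
proof -
  have "a * b * y = y * b * a * b * y \<longleftrightarrow> y * b * (a * b) = a * b"
  proof
    assume eq: "a * b * y = y * b * a * b * y"
    have "y * b * (a * b) = y * b * a * (b * y * b)"
      using inner by (simp add: mult.assoc)
    also have "\<dots> = (y * b * a * b * y) * b" by (simp add: mult.assoc)
    also have "\<dots> = a * (b * y * b)" using eq by (simp add: mult.assoc)
    finally show "y * b * (a * b) = a * b" using inner by simp
  next
    assume "y * b * (a * b) = a * b"
    then show "a * b * y = y * b * a * b * y" by (metis mult.assoc)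
  qed
  then show ?thesis
    using in_right_principal_outer_inverse_iff[OF outer] by simp
qed

theorem theorem4p11:
  fixes m a b :: "'a::involutive_ring"
  assumes "two_sided_invertible m"
    and "star m = m"
    and "a \<in> core_invertibles m"
    and "b \<in> core_invertibles m"
    and "a * b \<in> core_invertibles m"
  shows "core_inverse m (a * b) = core_inverse m b * core_inverse m a \<longleftrightarrow>
    b * core_inverse m (a * b) = b * core_inverse m b * core_inverse m a \<and>
    a * b * core_inverse m b = core_inverse m b * b * a * b * core_inverse m b"
proof -
  define x where "x = core_inverse m (a * b)"
  define y where "y = core_inverse m b"
  define z where "z = core_inverse m a"
  have x: "is_core_inverse m (a * b) x" and y: "is_core_inverse m b y"
    unfolding x_def y_def using assms by (simp_all add: is_core_inverse_core_inverse)
  have inner: "b * y * b = b" using y by (simp add: is_core_inverse_def)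
  have outer: "y * b * y = y" using is_core_inverse_outer[OF assms(1,2) y] .
  have "right_principal x = right_principal (a * b)"
    using x by (simp add: is_core_inverse_def)
  then have "x \<in> right_principal y \<longleftrightarrow> a * b \<in> right_principal y"
    using right_principal_subset_iff by metis
  then have absorbs: "a * b * y = y * b * a * b * y \<longleftrightarrow> x \<in> right_principal y"
    using in_right_principal_iff_absorbs[OF inner outer] by simp
  have "x = y * z \<longleftrightarrow> b * x = b * y * z \<and> x \<in> right_principal y"
  proof
    assume "x = y * z"
    then show "b * x = b * y * z \<and> x \<in> right_principal y"
      by (auto simp: right_principal_def mult.assoc)
  next
    assume R: "b * x = b * y * z \<and> x \<in> right_principal y"
    then have "y * b * x = x"
      using in_right_principal_outer_inverse_iff[OF outer] by simp
    then have "x = y * (b * x)" by (simp add: mult.assoc)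
    also have "\<dots> = y * b * y * z" using R by (simp add: mult.assoc)
    finally show "x = y * z" using outer by simp
  qed
  then show ?thesis
    using absorbs unfolding x_def y_def z_def by simp
qed

end
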